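(* For every integer $k\ge 1$, \[ \mathcal P_k=\mathcal P_k\biggl(\,\prod_{\substack{(u,v),(u',v')\in\mathcal S_k\\ (u,v)\ne(u',v')}}\operatorname{Res}(f_{(u,v),(u',v')},\Phi_k)\biggr), \] where $\operatorname{Res}(\cdot,\cdot)$ is the resultant.
   Context: $\mathbb Z_m=\mathbb Z/m\mathbb Z$ and, for a prime $r$, $\mathbb Z_r^*$ is the multiplicative group of $\mathbb Z_r$. For $k\ge1$, let $\mathcal S_k=\{(u,v)\in\mathbb Z_k^2: u\ne 0,\ v\ne 0,\ u\ne v\}$. For a prime $r\equiv 1\pmod k$, let $\omega$ be an element of order $k$ in $\mathbb Z_r^*$ and define \[ S:\mathcal S_k\to\mathbb Z_r^*\setminus\{-1\},\qquad S(u,v)=-\frac{1-\omega^v}{\omega^u-\omega^v}. \] (Whether $S$ is one-to-one does not depend on the choice of $\omega$.) $\mathcal P_k$ (no argument) denotes the set of primes $r$ such that $r>k+1$, $r\equiv 1\pmod k$, and $S:\mathcal S_k\to\mathbb Z_r^*\setminus\{-1\}$ is not one-to-one. For $m\in\mathbb Z$, $\mathcal P_k(m)$ denotes the set of prime divisors $r$ of $m$ such that $r>k+1$ and $r\equiv 1\pmod k$. For $(u,v),(u',v')\in\mathcal S_k$, with $u,v,u',v'$ represented by integers in $\{1,\dots,k-1\}$, \[ f_{(u,v),(u',v')}=(1-X^u)(1-X^{v'})-(1-X^{u'})(1-X^v)\in\mathbb Z[X]. \] $\Phi_k\in\mathbb Z[X]$ is the $k$th cyclotomic polynomial. An empty product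 is $1$. *)

theory Defs
  imports "HOL-Number_Theory.Residues" "Subresultants.Resultant_Prelim"
begin

definition primitive_roots_unity :: "nat \<Rightarrow> complex set" where
  "primitive_roots_unity n = {z. z ^ n = 1 \<and> (\<forall>j\<in>{1..<n}. z ^ j \<noteq> 1)}"

(* For n > 0 the described polynomial exists and is unique, see of_int_cyclotomic_poly below. *)
definition cyclotomic_poly :: "nat \<Rightarrow> int poly" where
  "cyclotomic_poly n = (THE p. map_poly of_int p = (\<Prod>z\<in>primitive_roots_unity n. [:-z, 1:]))"

(* The set S_k; classes modulo k are represented by their residues in {0..<k}. *)
definition pairs :: "nat \<Rightarrow> (nat \<times> nat) set" where
  "pairs k = {(u, v). u \<in> {0..<k} \<and> v \<in> {0..<k} \<and> u \<noteq> 0 \<and> v \<noteq> 0 \<and> u \<noteq> v}"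

definition has_order :: "nat \<Rightarrow> int \<Rightarrow> nat \<Rightarrow> bool" where
  "has_order r \<omega> k \<longleftrightarrow>
     \<omega> \<in> Units (residue_ring (int r)) \<and> group.ord (units_of (residue_ring (int r))) \<omega> = k"

definition S_map :: "nat \<Rightarrow> int \<Rightarrow> nat \<times> nat \<Rightarrow> int" where
  "S_map r \<omega> = (\<lambda>(u, v). let R = residue_ring (int r) in
     \<ominus>\<^bsub>R\<^esub> ((\<one>\<^bsub>R\<^esub> \<ominus>\<^bsub>R\<^esub> \<omega> [^]\<^bsub>R\<^esub> v) \<otimes>\<^bsub>R\<^esub> inv\<^bsub>R\<^esub> (\<omega> [^]\<^bsub>R\<^esub> u \<ominus>\<^bsub>R\<^esub> \<omega> [^]\<^bsub>R\<^esub> v)))"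

(* A suitable \<omega> always exists (ex_has_order) and the choice of \<omega> is
   immaterial (noninjective_primes_iff), so the quantifier over \<omega> could equally be universal. *)
definition noninjective_primes :: "nat \<Rightarrow> nat set" where
  "noninjective_primes k = {r. prime r \<and> r > k + 1 \<and> [r = 1] (mod k) \<and>
     (\<exists>\<omega>. has_order r \<omega> k \<and> \<not> inj_on (S_map r \<omega>) (pairs k))}"

definition prime_divisors_cong_1 :: "nat \<Rightarrow> int \<Rightarrow> nat set" where
  "prime_divisors_cong_1 k m = {r. prime r \<and> int r dvd m \<and> r > k + 1 \<and> [r = 1] (mod k)}"

definition f_poly :: "nat \<times> nat \<Rightarrow> nat \<times> nat \<Rightarrow> int poly" where
  "f_poly = (\<lambda>(u, v) (u', v').
     (1 - Polynomial.monom 1 u) * (1 - Polynomial.monom 1 v') -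
     (1 - Polynomial.monom 1 u') * (1 - Polynomial.monom 1 v))"


subsection \<open>Well-definedness of the cyclotomic polynomials\<close>

lemma finite_primitive_roots_unity: "n > 0 \<Longrightarrow> finite (primitive_roots_unity n)"
  by (rule finite_subset[OF _ finite_roots_unity[of n]]) (auto simp: primitive_roots_unity_def)

lemma roots_unity_eq_Union:
  assumes "n > 0"
  shows "{z :: complex. z ^ n = 1} = (\<Union>d\<in>{d. d dvd n}. primitive_roots_unity d)"
proof (intro Set.set_eqI iffI)
  fix z :: complex assume "z \<in> {z. z ^ n = 1}"
  hence z: "z ^ n = 1" by simp
  define d where "d = (LEAST d. d > 0 \<and> z ^ d = 1)"
  have d: "d > 0 \<and> z ^ d = 1" unfolding d_def by (rule LeastI[of _ n]) (use z assms in auto)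
  have min: "d \<le> j" if "j > 0" "z ^ j = 1" for j
    unfolding d_def by (rule Least_le) (use that in auto)
  have "z ^ n = z ^ (d * (n div d) + n mod d)" by simp
  also have "\<dots> = z ^ (n mod d)" unfolding power_add power_mult using d by simp
  finally have "n mod d = 0" using min[of "n mod d"] d z by (metis gr0I mod_less_divisor not_le)
  hence "d dvd n" by auto
  moreover have "z \<in> primitive_roots_unity d"
    unfolding primitive_roots_unity_def
  proof (intro CollectI conjI ballI notI)
    show "z ^ d = 1" using d by simp
    fix j assume "j \<in> {1..<d}" "z ^ j = 1"
    thus False using min[of j] by simp
  qed
  ultimately show "z \<in> (\<Union>d\<in>{d. d dvd n}. primitive_roots_unity d)" by auto
qed (auto simp: primitive_roots_unity_def power_mult elim!: dvdE)

lemma primitive_roots_unity_disjoint: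
  assumes "d > 0" "e > 0" "d \<noteq> e"
  shows "primitive_roots_unity d \<inter> primitive_roots_unity e = {}"
  using assms by (cases "d < e") (fastforce simp: primitive_roots_unity_def)+

lemma monic_prod_linear:
  fixes A :: "'a :: idom set"
  assumes "finite A"
  shows "degree (\<Prod>z\<in>A. [:-z, 1:]) = card A" "lead_coeff (\<Prod>z\<in>A. [:-z, 1:]) = 1"
  by (subst degree_prod_eq_sum_degree) (auto simp: lead_coeff_prod)

lemma prod_primitive_roots_unity:
  assumes "n > 0"
  shows "(\<Prod>d\<in>{d. d dvd n}. \<Prod>z\<in>primitive_roots_unity d. [:-z, 1:]) =
         (Polynomial.monom 1 n - 1 :: complex poly)"
proof -
  let ?A = "{z :: complex. z ^ n = 1}"
  have fin: "finite ?A" using assms finite_roots_unity[of n] by auto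
  have card: "card ?A = n" by (rule card_roots_unity_eq) fact
  have dvd_pos: "d > 0" if "d dvd n" for d using that assms by (auto intro: dvd_pos_nat)
  have "(\<Prod>d\<in>{d. d dvd n}. \<Prod>z\<in>primitive_roots_unity d. [:-z, 1:]) =
        (\<Prod>z\<in>(\<Union>d\<in>{d. d dvd n}. primitive_roots_unity d). [:-z, 1:])"
    by (rule prod.UNION_disjoint[symmetric])
       (use assms dvd_pos finite_primitive_roots_unity primitive_roots_unity_disjoint in auto)
  also have "\<dots> = (\<Prod>z\<in>?A. [:-z, 1:])" using roots_unity_eq_Union[OF assms] by simp
  also have "\<dots> = Polynomial.monom 1 n - 1"
  proof (rule poly_eqI_degree_lead_coeff[where A = ?A and n = n])
    have d: "degree (\<Prod>z\<in>?A. [:-z, 1:]) = n" "lead_coeff (\<Prod>z\<in>?A. [:-z, 1:]) = 1"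
      using monic_prod_linear[OF fin] card by auto
    show "degree (\<Prod>z\<in>?A. [:-z, 1:]) \<le> n" using d by simp
    show "degree (Polynomial.monom 1 n - 1 :: complex poly) \<le> n"
      by (rule degree_diff_le) (auto simp: degree_monom_le)
    show "poly.coeff (\<Prod>z\<in>?A. [:-z, 1:]) n = poly.coeff (Polynomial.monom 1 n - 1) n"
      using d assms by auto
    show "n \<le> card ?A" using card by simp
    show "poly (\<Prod>z\<in>?A. [:-z, 1:]) x = poly (Polynomial.monom 1 n - 1) x" if "x \<in> ?A" for x
      using that fin by (auto simp: poly_prod poly_monom)
  qed
  finally show ?thesis .
qed

lemma int_quotient:
  fixes P F :: "int poly" and C :: "complex poly"
  assumes "lead_coeff P = 1" "map_poly of_int P * C = map_poly of_int F"
  shows "\<exists>q. map_poly of_int q = C"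
proof -
  have P0: "P \<noteq> 0" using assms(1) by auto
  obtain q r where qr: "pseudo_divmod F P = (q, r)" by force
  from pseudo_divmod[OF P0 qr] assms(1)
  have F: "F = P * q + r" and r: "r = 0 \<or> degree r < degree P" by auto
  let ?h = "map_poly of_int :: int poly \<Rightarrow> complex poly"
  have "?h F = ?h P * ?h q + ?h r"
    unfolding F by (simp add: of_int_poly_hom.hom_add of_int_poly_hom.hom_mult)
  hence eq: "?h P * (C - ?h q) = ?h r" using assms(2) by (simp add: algebra_simps)
  have P0': "?h P \<noteq> 0" using P0 by simp
  have "C - ?h q = 0"
  proof (rule ccontr)
    assume *: "C - ?h q \<noteq> 0"
    hence "?h r \<noteq> 0" using eq P0' by (metis mult_eq_0_iff)
    hence "degree r < degree P" using r by auto
    moreover have "degree (?h r) = degree (?h P) + degree (C - ?h q)"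
      unfolding eq[symmetric] using P0' * by (rule degree_mult_eq)
    ultimately show False by simp
  qed
  thus ?thesis by (intro exI[of _ q]) simp
qed

lemma cyclotomic_poly_exists:
  "n > 0 \<Longrightarrow> \<exists>p :: int poly. map_poly of_int p = (\<Prod>z\<in>primitive_roots_unity n. [:-z, 1:])"
proof (induction n rule: less_induct)
  case (less n)
  let ?h = "map_poly of_int :: int poly \<Rightarrow> complex poly"
  let ?C = "\<lambda>n. \<Prod>z\<in>primitive_roots_unity n. [:-z, 1:]"
  let ?D = "{d. d dvd n \<and> d \<noteq> n}"
  have D: "0 < d \<and> d < n" if "d \<in> ?D" for d
    using that less.prems by (auto intro: dvd_pos_nat simp: dvd_imp_le le_neq_implies_less)
  have "\<forall>d\<in>?D. \<exists>p. ?h p = ?C d" using less.IH D by blast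
  then obtain p where p: "\<And>d. d \<in> ?D \<Longrightarrow> ?h (p d) = ?C d" by metis
  define P where "P = (\<Prod>d\<in>?D. p d)"
  have hP: "?h P = (\<Prod>d\<in>?D. ?C d)" unfolding P_def using p by (simp add: of_int_poly_hom.hom_prod)
  have "lead_coeff (?C d) = 1" if "d \<in> ?D" for d
    by (rule monic_prod_linear) (use D[OF that] finite_primitive_roots_unity in auto)
  hence "lead_coeff (?h P) = 1" unfolding hP lead_coeff_prod by (intro prod.neutral) (simp del: lead_coeff_prod)
  hence lead: "lead_coeff P = 1" by simp
  have "{d. d dvd n} = insert n ?D" by auto
  moreover have "finite ?D" by (rule finite_subset[of _ "{..n}"]) (use D in force)+
  ultimately have "?h P * ?C n = (\<Prod>d\<in>{d. d dvd n}. ?C d)" using less.prems hP by (simp add: mult.commute)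
  also have "\<dots> = ?h (Polynomial.monom 1 n - 1)"
    unfolding prod_primitive_roots_unity[OF less.prems]
    by (simp add: of_int_poly_hom.hom_minus)
  finally show ?case by (rule int_quotient[OF lead])
qed

lemma of_int_cyclotomic_poly:
  assumes "n > 0"
  shows "map_poly of_int (cyclotomic_poly n) = (\<Prod>z\<in>primitive_roots_unity n. [:-z, 1:])"
proof -
  obtain p :: "int poly"
    where p: "map_poly of_int p = (\<Prod>z\<in>primitive_roots_unity n. [:-z, 1:])"
    using cyclotomic_poly_exists[OF assms] by blast
  show ?thesis unfolding cyclotomic_poly_def
    by (rule theI[where a = p]) (rule p, simp only: p[symmetric] of_int_poly_hom.eq_iff)
qed


subsection \<open>Existence and independence of the choice of the element of order k\<close>

context residues_prime
begin

lemma units_of_eq: "units_of R = mult_of R"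
  by (simp add: mult_of_is_Units)

lemma has_order_iff:
  "has_order p w k \<longleftrightarrow> w \<in> carrier (mult_of R) \<and> group.ord (mult_of R) w = k"
  unfolding has_order_def R_def[symmetric]
  by (metis mult_of_is_Units units_of_carrier)

lemma has_order_powI:
  assumes "has_order p w k" "k > 0"
  shows "w \<in> carrier R" "w \<noteq> \<zero>" "w [^] k = \<one>" "inj_on (\<lambda>i::nat. w [^] i) {..<k}"
proof -
  interpret G: group "mult_of R" by (rule field_mult_group)
  have w: "w \<in> carrier (mult_of R)" "G.ord w = k" using assms by (auto simp: has_order_iff)
  show "w \<in> carrier R" "w \<noteq> \<zero>" using w by auto
  show "w [^] k = \<one>" using G.pow_ord_eq_1[OF w(1)] w(2) by (simp add: nat_pow_mult_of)
  have "{0..k - 1} = {..<k}" using assms(2) by auto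
  thus "inj_on (\<lambda>i::nat. w [^] i) {..<k}"
    using G.ord_inj[OF w(1)] w(2) by (simp add: nat_pow_mult_of)
qed

lemma pow_mod_order:
  assumes "has_order p w k" "k > 0"
  shows "w [^] (n mod k) = w [^] n"
proof -
  note w = has_order_powI[OF assms]
  have "w [^] n = w [^] (k * (n div k) + n mod k)" by simp
  also have "\<dots> = (w [^] k) [^] (n div k) \<otimes> w [^] (n mod k)"
    using w(1) by (simp only: nat_pow_mult nat_pow_pow)
  also have "\<dots> = w [^] (n mod k)" using w by simp
  finally show ?thesis by simp
qed

lemma has_order_eq_pow:
  assumes "has_order p w k" "has_order p w' k" "k > 0"
  obtains a :: nat where "w' = w [^] a"
proof -
  note w = has_order_powI[OF assms(1,3)] and w' = has_order_powI[OF assms(2,3)]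
  let ?X = "{x \<in> carrier R. x [^] k = \<one>}"
  have "(\<lambda>i::nat. w [^] i) ` {..<k} = ?X"
  proof (rule card_seteq)
    show "finite ?X" by simp
    have "(w [^] i) [^] k = \<one>" for i :: nat
      using w by (metis nat_pow_one nat_pow_pow mult.commute)
    thus "(\<lambda>i::nat. w [^] i) ` {..<k} \<subseteq> ?X" using w by auto
    show "card ?X \<le> card ((\<lambda>i::nat. w [^] i) ` {..<k})"
      using num_roots_le_deg[of k] assms(3) w(4) by (simp add: card_image)
  qed
  moreover have "w' \<in> ?X" using w' by simp
  ultimately show ?thesis using that by blast
qed

lemma inj_S_map_mono:
  assumes "has_order p w k" "has_order p w' k" "k > 0" "inj_on (S_map p w) (pairs k)"
  shows "inj_on (S_map p w') (pairs k)"
proof -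
  note w = has_order_powI[OF assms(1,3)] and w' = has_order_powI[OF assms(2,3)]
  obtain a :: nat where a: "w' = w [^] a" by (rule has_order_eq_pow[OF assms(1-3)])
  define h where "h = (\<lambda>u. a * u mod k)"
  have pow_h: "w [^] h u = w' [^] u" for u
    unfolding h_def a pow_mod_order[OF assms(1,3)] using w(1) by (simp add: nat_pow_pow)
  have inj_h: "u = v" if "h u = h v" "u < k" "v < k" for u v
    using inj_onD[OF w'(4), of u v] that pow_h by (metis lessThan_iff)
  have h0: "h 0 = 0" by (simp add: h_def)
  have h_less: "h u < k" for u using assms(3) by (simp add: h_def)
  have S: "S_map p w' (u, v) = S_map p w (h u, h v)" for u v
    by (simp add: S_map_def Let_def R_def[symmetric] pow_h)
  have maps: "(h u, h v) \<in> pairs k" if "(u, v) \<in> pairs k" for u v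
  proof -
    have uv: "u < k" "v < k" "u \<noteq> 0" "v \<noteq> 0" "u \<noteq> v" using that by (auto simp: pairs_def)
    have "h u \<noteq> 0" "h v \<noteq> 0" "h u \<noteq> h v"
      using inj_h[of u 0] inj_h[of v 0] inj_h[of u v] uv h0 assms(3) by auto
    thus ?thesis using h_less by (simp add: pairs_def)
  qed
  show ?thesis
  proof (rule inj_onI, clarify)
    fix u v u' v' assume *: "(u, v) \<in> pairs k" "(u', v') \<in> pairs k"
      "S_map p w' (u, v) = S_map p w' (u', v')"
    hence "(h u, h v) = (h u', h v')" using inj_onD[OF assms(4)] maps by (metis S)
    thus "u = u' \<and> v = v'" using * inj_h by (auto simp: pairs_def)
  qed
qed

lemma S_map_in_codomain:
  assumes "has_order p w k" "k > 0" "(u, v) \<in> pairs k"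
  shows "S_map p w (u, v) \<in> Units R - {\<ominus> \<one>}"
proof -
  note w = has_order_powI[OF assms(1,2)]
  let ?x = "w [^] u" and ?y = "w [^] v"
  have c: "?x \<in> carrier R" "?y \<in> carrier R" using w by auto
  have uv: "u < k" "v < k" "u \<noteq> 0" "v \<noteq> 0" "u \<noteq> v" using assms(3) by (auto simp: pairs_def)
  have xy: "?x \<noteq> ?y" using inj_onD[OF w(4), of u v] uv by auto
  have y1: "\<one> \<noteq> ?y" using inj_onD[OF w(4), of 0 v] uv by auto
  have x1: "\<one> \<noteq> ?x" using inj_onD[OF w(4), of 0 u] uv by auto
  have d: "?x \<ominus> ?y \<in> Units R" using c xy by (simp add: field_Units)
  have n: "\<one> \<ominus> ?y \<in> Units R" using c y1 by (simp add: field_Units)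
  let ?q = "(\<one> \<ominus> ?y) \<otimes> inv (?x \<ominus> ?y)"
  have q: "?q \<in> Units R" using d n by simp
  have S: "S_map p w (u, v) = \<ominus> ?q" by (simp add: S_map_def Let_def R_def[symmetric])
  have "\<ominus> ?q \<in> Units R" using q by (simp add: field_Units)
  moreover have "\<ominus> ?q \<noteq> \<ominus> \<one>"
  proof
    assume "\<ominus> ?q = \<ominus> \<one>"
    hence "?q = \<one>" using q by (metis Units_closed minus_minus one_closed)
    moreover have "?q \<otimes> (?x \<ominus> ?y) = \<one> \<ominus> ?y"
      using d n by (simp only: m_assoc Units_closed Units_inv_closed Units_inv_Units Units_l_inv r_one)
    ultimately have "\<one> \<ominus> ?y = ?x \<ominus> ?y" using d by (simp only: l_one Units_closed)
    hence "\<one> = ?x" using c by (simp add: a_minus_def)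
    thus False using x1 by simp
  qed
  ultimately show ?thesis by (simp add: S)
qed

lemma ex_has_order:
  assumes "[p = 1] (mod k)" "k > 0"
  shows "\<exists>w. has_order p w k"
proof -
  interpret G: group "mult_of R" by (rule field_mult_group)
  obtain g where g: "g \<in> carrier (mult_of R)"
      and gen: "carrier (mult_of R) = {g [^] i | i::nat. i \<in> UNIV}"
    using finite_field_mult_group_has_gen[OF finite] by blast
  have fin: "Finite_Set.finite (carrier (mult_of R))" by simp
  have ord: "G.ord g = p - 1"
  proof -
    have "generate (mult_of R) {g} = carrier (mult_of R)"
      using G.generate_pow_on_finite_carrier[OF fin g] gen by (auto simp: nat_pow_mult_of)
    hence "G.ord g = card (carrier (mult_of R))" using G.generate_pow_card[OF g] by simp
    also have "carrier (mult_of R) = {1..int p - 1}"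
      by (auto simp: res_carrier_eq res_zero_eq)
    finally show ?thesis by simp
  qed
  have p1: "p > 1" using p_prime by (rule prime_gt_1_nat)
  have "k dvd p - 1" using assms(1) p1 by (simp add: cong_altdef_nat cong_sym_eq)
  then obtain m where m: "p - 1 = k * m" by blast
  hence m0: "m > 0" using p1 by (cases m) auto
  have "G.ord (g [^]\<^bsub>mult_of R\<^esub> m) = k"
    using G.ord_pow_gen[OF g, of m] ord m m0 by (simp)
  moreover have "g [^]\<^bsub>mult_of R\<^esub> m \<in> carrier (mult_of R)" using g by (rule G.nat_pow_closed)
  ultimately show ?thesis unfolding has_order_iff by blast
qed

end

lemma ex_has_order:
  assumes "prime r" "[r = 1] (mod k)" "k > 0"
  shows "\<exists>\<omega>. has_order r \<omega> k"
proof -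
  interpret residues_prime r "residue_ring (int r)" by unfold_locales fact
  show ?thesis using ex_has_order assms by blast
qed

lemma S_map_in_codomain:
  assumes "prime r" "has_order r \<omega> k" "k > 0"
  shows "S_map r \<omega> ` pairs k \<subseteq>
    Units (residue_ring (int r)) - {\<ominus>\<^bsub>residue_ring (int r)\<^esub> \<one>\<^bsub>residue_ring (int r)\<^esub>}"
proof -
  interpret residues_prime r "residue_ring (int r)" by unfold_locales fact
  show ?thesis using S_map_in_codomain[OF assms(2,3)] by (auto)
qed

lemma noninjective_primes_iff:
  assumes "has_order r \<omega> k" "k > 0"
  shows "r \<in> noninjective_primes k \<longleftrightarrow>
    prime r \<and> r > k + 1 \<and> [r = 1] (mod k) \<and> \<not> inj_on (S_map r \<omega>) (pairs k)"
proof (cases "prime r")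
  case True
  interpret residues_prime r "residue_ring (int r)" by unfold_locales fact
  have "inj_on (S_map r \<omega>') (pairs k)"
    if "has_order r \<omega>' k" "inj_on (S_map r \<omega>) (pairs k)" for \<omega>'
    by (rule inj_S_map_mono[OF assms(1) that(1) assms(2) that(2)])
  thus ?thesis unfolding noninjective_primes_def using assms(1) by auto
qed (simp add: noninjective_primes_def)

end

theory Submission
  imports Defs "Subresultants.Subresultant"
begin

text \<open>
  Fix a prime \<open>r\<close> with \<open>r \<equiv> 1\<close> modulo \<open>k\<close>. Clearing denominators, a collision
  \<open>S (u, v) = S (u', v')\<close> for an element \<open>\<omega>\<close> of order \<open>k\<close> says
  \<open>(1 - \<omega>^v) (\<omega>^u' - \<omega>^v') = (1 - \<omega>^v') (\<omega>^u - \<omega>^v)\<close>; the terms \<open>\<omega>^(v + v')\<close> cancel and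
  what is left is \<open>f \<omega> = 0\<close> for \<open>f\<close> the polynomial attached to the two pairs
  (\<open>S_map_eq_iff\<close> below). So the question is when \<open>f\<close> has an element of order \<open>k\<close> as a root
  modulo \<open>r\<close>.

  The elements of order \<open>k\<close> are the powers \<open>\<omega>^a\<close> with \<open>a\<close> coprime to \<open>k\<close>, and modulo \<open>r\<close> the
  cyclotomic polynomial splits as the product of the \<open>X - \<omega>^a\<close>. Hence its resultant with \<open>f\<close> is
  congruent, up to sign, to the product of the values \<open>f (\<omega>^a)\<close>, and \<open>r\<close> divides the resultant
  iff one of these values vanishes (\<open>prime_dvd_resultant_cyclotomic_iff\<close>). The theorem follows
  because a prime divides a product iff it divides a factor.

  The argument stays inside the integers, with congruences instead of polynomials over the
  residue field: reducing \<open>f\<close> modulo \<open>r\<close> may lower its degree and so change the Sylvester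
  matrix, whereas over the integers only the monic cyclotomic polynomial is replaced, by a
  congruent polynomial of the same degree (\<open>resultant_cong\<close>). The product formula for the
  resultant with a split polynomial (\<open>resultant_prod_linear\<close>) then holds exactly.
\<close>

section \<open>Resultants with a split polynomial\<close>

text \<open>
  The columns list the coefficients by decreasing degree, as in the Sylvester matrix. Determinants
  of such matrices can be manipulated through the polynomials in the rows.
\<close>

definition coeff_mat :: "nat \<Rightarrow> (nat \<Rightarrow> 'a :: zero poly) \<Rightarrow> 'a mat" where
  "coeff_mat N P = mat N N (\<lambda>(i, j). poly.coeff (P i) (N - Suc j))"

text \<open>
  The single unimodular matrix behind the product formula. Multiplied from the left, it subtracts
  from each row a multiple of the next one; multiplied from the right with all \<open>e i\<close> equal to
  \<open>c\<close>, it converts coordinates with respect to the basis \<open>(X - c) X^l, 1\<close> into coefficients.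
\<close>

definition upper_bidiagonal :: "nat \<Rightarrow> (nat \<Rightarrow> 'a :: comm_ring_1) \<Rightarrow> 'a mat" where
  "upper_bidiagonal N e = mat N N (\<lambda>(i, j). if i = j then 1 else if j = Suc i then - e i else 0)"

lemma coeff_mat_carrier [simp]: "coeff_mat N P \<in> carrier_mat N N"
  by (simp add: coeff_mat_def)

lemma upper_bidiagonal_carrier [simp]: "upper_bidiagonal N e \<in> carrier_mat N N"
  by (simp add: upper_bidiagonal_def)

lemma det_upper_bidiagonal: "det (upper_bidiagonal N e) = 1"
proof -
  have ut: "upper_triangular (upper_bidiagonal N e)"
    by (auto simp: upper_triangular_def upper_bidiagonal_def)
  have "diag_mat (upper_bidiagonal N e) = replicate N 1"
    by (rule nth_equalityI) (auto simp: diag_mat_def upper_bidiagonal_def)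
  thus ?thesis using det_upper_triangular[OF ut upper_bidiagonal_carrier] by simp
qed

lemma mat_mult_index:
  assumes "A \<in> carrier_mat N N" "B \<in> carrier_mat N N" "i < N" "j < N"
  shows "(A * B) $$ (i, j) = (\<Sum>l<N. A $$ (i, l) * B $$ (l, j))"
  using assms by (auto simp: scalar_prod_def atLeast0LessThan intro!: sum.cong)

lemma mult_upper_bidiagonal_index:
  assumes "A \<in> carrier_mat N N" "i < N" "j < N"
  shows "(A * upper_bidiagonal N e) $$ (i, j) =
    A $$ (i, j) - (case j of 0 \<Rightarrow> 0 | Suc l \<Rightarrow> e l * A $$ (i, l))"
proof -
  have "(A * upper_bidiagonal N e) $$ (i, j) =
      (\<Sum>l<N. (if l = j then A $$ (i, l) else 0) - (if j = Suc l then e l * A $$ (i, l) else 0))"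
    using assms by (subst mat_mult_index[OF assms(1) upper_bidiagonal_carrier assms(2,3)], intro sum.cong)
      (auto simp: upper_bidiagonal_def)
  also have "\<dots> = A $$ (i, j) - (\<Sum>l<N. if j = Suc l then e l * A $$ (i, l) else 0)"
    using assms by (simp add: sum_subtractf)
  also have "(\<Sum>l<N. if j = Suc l then e l * A $$ (i, l) else 0) =
      (case j of 0 \<Rightarrow> 0 | Suc l \<Rightarrow> e l * A $$ (i, l))"
    using assms by (cases j) auto
  finally show ?thesis .
qed

lemma upper_bidiagonal_mult_index:
  assumes "A \<in> carrier_mat N N" "i < N" "j < N"
  shows "(upper_bidiagonal N e * A) $$ (i, j) =
    A $$ (i, j) - (if Suc i < N then e i * A $$ (Suc i, j) else 0)"
proof -
  have "(upper_bidiagonal N e * A) $$ (i, j) =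
      (\<Sum>l<N. (if l = i then A $$ (l, j) else 0) - (if l = Suc i then e i * A $$ (l, j) else 0))"
    using assms by (subst mat_mult_index[OF upper_bidiagonal_carrier assms], intro sum.cong)
      (auto simp: upper_bidiagonal_def)
  also have "\<dots> = A $$ (i, j) - (if Suc i < N then e i * A $$ (Suc i, j) else 0)"
    using assms by (simp add: sum_subtractf)
  finally show ?thesis .
qed

lemma det_coeff_mat_row_operations:
  fixes P P' :: "nat \<Rightarrow> 'a :: idom poly"
  assumes "\<And>i. i < N \<Longrightarrow> P' i = P i - (if Suc i < N then smult (e i) (P (Suc i)) else 0)"
  shows "det (coeff_mat N P') = det (coeff_mat N P)"
proof -
  have "coeff_mat N P' = upper_bidiagonal N e * coeff_mat N P"
  proof (rule eq_matI)
    fix i j assume "i < dim_row (upper_bidiagonal N e * coeff_mat N P)"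
      "j < dim_col (upper_bidiagonal N e * coeff_mat N P)"
    hence ij: "i < N" "j < N" by (auto simp: upper_bidiagonal_def coeff_mat_def)
    show "coeff_mat N P' $$ (i, j) = (upper_bidiagonal N e * coeff_mat N P) $$ (i, j)"
      unfolding upper_bidiagonal_mult_index[OF coeff_mat_carrier ij]
      using ij assms[OF ij(1)] by (auto simp: coeff_mat_def)
  qed (auto simp: upper_bidiagonal_def coeff_mat_def)
  thus ?thesis
    by (simp add: det_mult[OF upper_bidiagonal_carrier coeff_mat_carrier] det_upper_bidiagonal)
qed

text \<open>
  In the basis \<open>(X - c) X^l, 1\<close> a multiple of \<open>X - c\<close> has last coordinate \<open>0\<close> and the
  coefficients of its quotient as the other coordinates, while the last coordinate of \<open>h\<close> is
  \<open>h c\<close>. The matrix is therefore block triangular after this unimodular change of basis.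
\<close>

lemma det_coeff_mat_linear_factor:
  fixes Q :: "nat \<Rightarrow> 'a :: idom poly"
  assumes Q: "\<And>i. i < N \<Longrightarrow> degree (Q i) < N" and h: "degree h \<le> N"
  shows "det (coeff_mat (Suc N) (\<lambda>i. if i < N then [:-c, 1:] * Q i else h)) =
    det (coeff_mat N Q) * poly h c"
proof -
  \<comment> \<open>row \<open>i\<close> is \<open>(X - c) P i + s i\<close>\<close>
  define P where "P = (\<lambda>i. if i < N then Q i else synthetic_div h c)"
  define s where "s = (\<lambda>i. if i < N then 0 else poly h c)"
  define B where "B = four_block_mat (coeff_mat N Q) (0\<^sub>m N 1)
    (mat 1 N (\<lambda>(_, j). poly.coeff (synthetic_div h c) (N - Suc j))) (mat 1 1 (\<lambda>_. poly h c))"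
  have B: "B \<in> carrier_mat (Suc N) (Suc N)"
    using four_block_carrier_mat[of "coeff_mat N Q" N N "mat 1 1 (\<lambda>_. poly h c)" 1 1]
    by (simp add: B_def)
  have Bij: "B $$ (i, j) = (if j < N then poly.coeff (P i) (N - Suc j) else s i)"
    if "i < Suc N" "j < Suc N" for i j
    using that by (auto simp: B_def P_def s_def coeff_mat_def less_Suc_eq)
  have row: "(if i < N then [:-c, 1:] * Q i else h) = [:-c, 1:] * P i + [:s i:]" for i
    by (simp add: P_def s_def synthetic_div_correct'[of c h] del: mult_pCons_left pCons_one)
  \<comment> \<open>needed for column \<open>0\<close>, where \<open>- c P i\<close> would contribute to the coefficient of \<open>X^N\<close>\<close>
  have P_N: "poly.coeff (P i) N = 0" for i
  proof (cases "degree h = 0")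
    case True
    hence "synthetic_div h c = 0" by (simp add: synthetic_div_eq_0_iff)
    thus ?thesis using Q by (simp add: P_def coeff_eq_0)
  next
    case False
    hence "degree (synthetic_div h c) < N" using h by (simp add: degree_synthetic_div)
    thus ?thesis using Q by (simp add: P_def coeff_eq_0)
  qed
  have "coeff_mat (Suc N) (\<lambda>i. if i < N then [:-c, 1:] * Q i else h) =
      B * upper_bidiagonal (Suc N) (\<lambda>_. c)"
  proof (rule eq_matI)
    fix i j assume "i < dim_row (B * upper_bidiagonal (Suc N) (\<lambda>_. c))"
      "j < dim_col (B * upper_bidiagonal (Suc N) (\<lambda>_. c))"
    hence ij: "i < Suc N" "j < Suc N" using B by (auto simp: upper_bidiagonal_def)
    have "coeff_mat (Suc N) (\<lambda>i. if i < N then [:-c, 1:] * Q i else h) $$ (i, j) =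
        poly.coeff ([:-c, 1:] * P i + [:s i:]) (N - j)"
      using ij by (simp add: coeff_mat_def row del: mult_pCons_left)
    also have "\<dots> = B $$ (i, j) - (case j of 0 \<Rightarrow> 0 | Suc l \<Rightarrow> c * B $$ (i, l))"
    proof (cases "j < N")
      case True
      hence "N - j = Suc (N - Suc j)" by simp
      thus ?thesis using ij P_N[of i] True by (cases j) (auto simp: Bij coeff_pCons split: nat.split)
    next
      case False
      hence "j = N" using ij by simp
      thus ?thesis using ij P_N[of i] by (cases j) (auto simp: Bij)
    qed
    finally show "coeff_mat (Suc N) (\<lambda>i. if i < N then [:-c, 1:] * Q i else h) $$ (i, j) =
        (B * upper_bidiagonal (Suc N) (\<lambda>_. c)) $$ (i, j)"
      by (simp add: mult_upper_bidiagonal_index[OF B ij])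
  qed (use B in \<open>auto simp: upper_bidiagonal_def coeff_mat_def\<close>)
  moreover have "det B = det (coeff_mat N Q) * poly h c"
    unfolding B_def by (subst det_four_block_mat_upper_right_zero_col[of _ N]) (auto simp: det_single)
  ultimately show ?thesis
    by (simp add: det_mult[OF B upper_bidiagonal_carrier] det_upper_bidiagonal)
qed

lemma sylvester_mat_eq_coeff_mat:
  fixes f g :: "'a :: comm_ring_1 poly"
  shows "sylvester_mat g f = coeff_mat (degree g + degree f)
    (\<lambda>i. if i < degree f then Polynomial.monom 1 (degree f - Suc i) * g
         else Polynomial.monom 1 (degree g + degree f - Suc i) * f)"
proof (rule eq_matI)
  let ?N = "degree g + degree f"
  let ?P = "\<lambda>i. if i < degree f then Polynomial.monom 1 (degree f - Suc i) * g
         else Polynomial.monom 1 (?N - Suc i) * f"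
  fix i j assume "i < dim_row (coeff_mat ?N ?P)" "j < dim_col (coeff_mat ?N ?P)"
  hence ij: "i < ?N" "j < ?N" by (auto simp: coeff_mat_def)
  show "sylvester_mat g f $$ (i, j) = coeff_mat ?N ?P $$ (i, j)"
    unfolding sylvester_index_mat2[OF ij] using ij
    by (auto simp: coeff_mat_def coeff_monom_mult)
qed (auto simp: coeff_mat_def)

text \<open>
  The Sylvester matrix has the rows \<open>X^i (X - c) g\<close> followed by \<open>X^n f, \<dots>, X f, f\<close>. Subtracting
  \<open>c\<close> times its successor \<open>X^i f\<close> turns \<open>X^(i + 1) f\<close> into \<open>X - c\<close> times \<open>X^i f\<close>. Now every row but the last is divisible by \<open>X - c\<close>, and the quotients are the rows of
  the Sylvester matrix of \<open>g\<close> and \<open>f\<close>.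
\<close>

lemma resultant_linear_factor:
  fixes f g :: "'a :: idom poly"
  assumes "g \<noteq> 0"
  shows "resultant ([:-c, 1:] * g) f = poly f c * resultant g f"
proof -
  let ?m = "degree f" and ?N = "degree g + degree f"
  \<comment> \<open>the Sylvester rows of \<open>g\<close> and \<open>f\<close>, and those of \<open>(X - c) g\<close> and \<open>f\<close>\<close>
  define R where "R = (\<lambda>i. if i < ?m then Polynomial.monom 1 (?m - Suc i) * g
    else Polynomial.monom 1 (?N - Suc i) * f)"
  define S where "S = (\<lambda>i. if i < ?m then Polynomial.monom 1 (?m - Suc i) * ([:-c, 1:] * g)
    else Polynomial.monom 1 (?N - i) * f)"
  have deg: "degree ([:-c, 1:] * g) = Suc (degree g)"
    using assms by (subst degree_mult_eq) auto
  have R_deg: "degree (R i) < ?N" if "i < ?N" for i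
  proof (cases "f = 0")
    case True
    thus ?thesis using that by (auto simp: R_def)
  next
    case False
    thus ?thesis using that assms by (auto simp: R_def degree_mult_eq degree_monom_eq)
  qed
  have "resultant ([:-c, 1:] * g) f = det (coeff_mat (Suc ?N) S)"
    unfolding resultant_def sylvester_mat_eq_coeff_mat deg
    by (simp add: S_def del: mult_pCons_left cong: if_cong)
  also have "\<dots> = det (coeff_mat (Suc ?N) (\<lambda>i. if i < ?N then [:-c, 1:] * R i else f))"
  proof (rule det_coeff_mat_row_operations[symmetric, where e = "\<lambda>i. if i < ?m then 0 else c"])
    fix i assume i: "i < Suc ?N"
    have shift: "[:-c, 1:] * (Polynomial.monom 1 n * f) =
        Polynomial.monom 1 (Suc n) * f - smult c (Polynomial.monom 1 n * f)" for n
      by (simp add: monom_Suc)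
    consider "i < ?m" | "?m \<le> i" "i < ?N" | "i = ?N" using i by linarith
    thus "(if i < ?N then [:-c, 1:] * R i else f) =
        S i - (if Suc i < Suc ?N then smult (if i < ?m then 0 else c) (S (Suc i)) else 0)"
    proof cases
      case 2
      hence "?N - i = Suc (?N - Suc i)" by simp
      thus ?thesis using 2 shift[of "?N - Suc i"]
        by (simp add: R_def S_def del: mult_pCons_left)
    qed (auto simp: R_def S_def mult.left_commute simp del: mult_pCons_left)
  qed
  also have "\<dots> = det (coeff_mat ?N R) * poly f c"
    by (rule det_coeff_mat_linear_factor) (use R_deg in auto)
  also have "det (coeff_mat ?N R) = resultant g f"
    unfolding resultant_def sylvester_mat_eq_coeff_mat R_def ..
  finally show ?thesis by (simp add: mult.commute)
qed

lemma resultant_prod_linear: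
  fixes f :: "'a :: idom poly"
  assumes "finite A"
  shows "resultant (\<Prod>c\<in>A. [:-c, 1:]) f = (\<Prod>c\<in>A. poly f c)"
  using assms
proof (induction A)
  case (insert c A)
  have "(\<Prod>c\<in>A. [:-c, 1:]) \<noteq> 0" using insert.hyps by simp
  thus ?case using insert by (simp add: resultant_linear_factor del: mult_pCons_left pCons_one)
qed simp


section \<open>Integer polynomials modulo a prime\<close>

lemma int_poly_cong:
  fixes P :: "int poly"
  assumes "[x = y] (mod m)"
  shows "[poly P x = poly P y] (mod m)"
  by (induction P) (auto intro!: cong_add cong_mult assms)

text \<open>
  Equality of the degrees is essential: it makes the two Sylvester matrices the same size, so that
  they are congruent entry by entry.
\<close>

lemma resultant_cong:
  fixes f g g' :: "int poly"
  assumes "degree g = degree g'" "\<And>i. [poly.coeff g i = poly.coeff g' i] (mod m)"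
  shows "[resultant g f = resultant g' f] (mod m)"
proof -
  let ?N = "degree g + degree f"
  have entry: "[sylvester_mat g f $$ (i, j) = sylvester_mat g' f $$ (i, j)] (mod m)"
    if "i < ?N" "j < ?N" for i j
    using that assms by (auto simp: sylvester_index_mat)
  have carrier: "sylvester_mat g f \<in> carrier_mat ?N ?N" "sylvester_mat g' f \<in> carrier_mat ?N ?N"
    using assms(1) by (auto simp: sylvester_carrier_mat)
  show ?thesis
    unfolding resultant_def det_def'[OF carrier(1)] det_def'[OF carrier(2)]
    by (intro cong_sum cong_mult cong_refl cong_prod entry)
       (use permutes_in_image in fastforce)+
qed

text \<open>
  The bound on the number of roots over the field with \<open>p\<close> elements, for integer representatives.
  Splitting off one root \<open>a\<close>, the quotient vanishes at the others because \<open>p\<close> does not divide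
  their differences with \<open>a\<close>.
\<close>

lemma prime_dvd_coeffs_if_many_roots:
  fixes P :: "int poly" and p :: int
  assumes "prime p" "finite A" "degree P < card A"
    and "\<And>a. a \<in> A \<Longrightarrow> p dvd poly P a"
    and "\<And>a b. a \<in> A \<Longrightarrow> b \<in> A \<Longrightarrow> [a = b] (mod p) \<Longrightarrow> a = b"
  shows "p dvd poly.coeff P i"
  using assms(2-)
proof (induction A arbitrary: P i)
  case (insert a A)
  let ?Q = "synthetic_div P a"
  have P: "P = [:-a, 1:] * ?Q + [:poly P a:]" by (rule synthetic_div_correct'[symmetric])
  have Q: "p dvd poly.coeff ?Q j" for j
  proof (cases "degree P = 0")
    case True
    hence "?Q = 0" by (simp add: synthetic_div_eq_0_iff)
    thus ?thesis by simp
  next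
    case False
    show ?thesis
    proof (rule insert.IH)
      show "degree ?Q < card A"
        using False insert.prems(1) insert.hyps by (simp add: degree_synthetic_div)
      show "p dvd poly ?Q b" if b: "b \<in> A" for b
      proof -
        have "poly P b = (b - a) * poly ?Q b + poly P a"
          by (subst P) (simp add: algebra_simps)
        moreover have "p dvd poly P b" "p dvd poly P a" using insert.prems(2) b by auto
        ultimately have "p dvd (b - a) * poly ?Q b" by (simp add: dvd_add_left_iff)
        moreover have "\<not> p dvd b - a"
          using insert.prems(3)[of b a] insert.hyps b by (auto simp: cong_iff_dvd_diff)
        ultimately show ?thesis using \<open>prime p\<close> by (simp add: prime_dvd_mult_iff)
      qed
    qed (use insert.prems(3) in auto)
  qed
  have "p dvd poly P a" using insert.prems(2) by simp
  thus ?case by (subst P) (auto simp: coeff_pCons Q split: nat.split)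
qed simp

text \<open>
  The difference of two monic polynomials of the same degree has too small a degree to vanish at
  all the roots.
\<close>

lemma monic_cong_prod_roots:
  fixes P :: "int poly" and p :: int
  assumes "prime p" "finite A" "lead_coeff P = 1" "degree P = card A"
    and "\<And>a. a \<in> A \<Longrightarrow> p dvd poly P a"
    and "\<And>a b. a \<in> A \<Longrightarrow> b \<in> A \<Longrightarrow> [a = b] (mod p) \<Longrightarrow> a = b"
  shows "[poly.coeff P i = poly.coeff (\<Prod>a\<in>A. [:-a, 1:]) i] (mod p)"
proof (cases "card A = 0")
  case True
  hence "A = {}" "P = 1" using assms(2,3,4) by (auto elim!: degree_eq_zeroE)
  thus ?thesis by simp
next
  case False
  let ?G = "\<Prod>a\<in>A. [:-a, 1:]"
  note G = monic_prod_linear[OF assms(2)]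
  have le: "degree (P - ?G) \<le> card A"
    by (rule degree_diff_le) (use assms(4) G(1) in auto)
  have "degree (P - ?G) < card A"
  proof (rule ccontr)
    assume "\<not> degree (P - ?G) < card A"
    hence "degree (P - ?G) = card A" using le by simp
    moreover from this have "lead_coeff (P - ?G) = 0"
      using assms(3,4) G by simp
    ultimately show False using False by (metis degree_0 leading_coeff_0_iff)
  qed
  moreover have "p dvd poly (P - ?G) a" if "a \<in> A" for a
  proof -
    have "poly ?G a = 0" using assms(2) that by (auto simp: poly_prod)
    thus ?thesis using assms(5)[OF that] by simp
  qed
  ultimately have "p dvd poly.coeff (P - ?G) i"
    using prime_dvd_coeffs_if_many_roots[OF assms(1,2)] assms(6) by blast
  thus ?thesis by (simp add: cong_iff_dvd_diff)
qed


section \<open>Cyclotomic polynomials modulo a prime\<close>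

lemma
  assumes "n > 0"
  shows degree_cyclotomic_poly_eq_card: "degree (cyclotomic_poly n) = card (primitive_roots_unity n)"
    and lead_coeff_cyclotomic_poly: "lead_coeff (cyclotomic_poly n) = 1"
proof -
  note monic = monic_prod_linear[OF finite_primitive_roots_unity[OF assms],
      folded of_int_cyclotomic_poly[OF assms]]
  show "degree (cyclotomic_poly n) = card (primitive_roots_unity n)"
    and "lead_coeff (cyclotomic_poly n) = 1"
    using monic by simp_all
qed

lemma prod_cyclotomic_poly:
  assumes "n > 0"
  shows "(\<Prod>d | d dvd n. cyclotomic_poly d) = Polynomial.monom 1 n - 1"
proof -
  let ?h = "map_poly of_int :: int poly \<Rightarrow> complex poly"
  have "?h (\<Prod>d | d dvd n. cyclotomic_poly d) = (\<Prod>d | d dvd n. ?h (cyclotomic_poly d))"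
    by (rule of_int_poly_hom.hom_prod)
  also have "\<dots> = (\<Prod>d | d dvd n. \<Prod>z\<in>primitive_roots_unity d. [:-z, 1:])"
    using assms by (intro prod.cong of_int_cyclotomic_poly) (auto intro: dvd_pos_nat)
  also have "\<dots> = ?h (Polynomial.monom 1 n - 1)"
    unfolding prod_primitive_roots_unity[OF assms] by (simp add: of_int_poly_hom.hom_minus)
  finally show ?thesis by (simp only: of_int_poly_hom.eq_iff)
qed

text \<open>
  Both sides have the same divisor sum: \<open>\<Sum>d | d dvd n. totient d = n\<close>, and the cyclotomic
  polynomials multiply up to \<open>X^n - 1\<close>. Induction on \<open>n\<close> removes the proper divisors.
\<close>

lemma degree_cyclotomic_poly:
  assumes "n > 0"
  shows "degree (cyclotomic_poly n) = totient n"
  using assms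
proof (induction n rule: less_induct)
  case (less n)
  let ?D = "{d. d dvd n}"
  have pos: "d > 0" if "d \<in> ?D" for d using that less.prems by (auto intro: dvd_pos_nat)
  have fin: "finite ?D" using less.prems by simp
  have nz: "cyclotomic_poly d \<noteq> 0" if "d \<in> ?D" for d
    using lead_coeff_cyclotomic_poly[OF pos[OF that]] by auto
  have "(\<Sum>d\<in>?D. degree (cyclotomic_poly d)) = degree (Polynomial.monom 1 n - 1 :: int poly)"
    using nz by (simp flip: prod_cyclotomic_poly[OF less.prems] add: degree_prod_eq_sum_degree)
  also have "\<dots> = n"
    using less.prems degree_add_eq_left[of "- 1" "Polynomial.monom (1::int) n"]
    by (simp add: degree_monom_eq)
  also have "\<dots> = (\<Sum>d\<in>?D. totient d)" by (simp add: totient_divisor_sum)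
  finally have "(\<Sum>d\<in>?D. degree (cyclotomic_poly d)) = (\<Sum>d\<in>?D. totient d)" .
  moreover have "(\<Sum>d\<in>?D-{n}. degree (cyclotomic_poly d)) = (\<Sum>d\<in>?D-{n}. totient d)"
  proof (intro sum.cong refl less.IH)
    fix d assume "d \<in> ?D - {n}"
    thus "d < n" "d > 0" using less.prems pos by (auto dest: dvd_imp_le intro: le_neq_implies_less)
  qed
  ultimately show ?case
    using fin by (simp add: sum.remove[of ?D n])
qed

text \<open>
  Being of exact order \<open>k\<close> in the form that the proofs use, for arbitrary integer representatives.
  Unlike membership in a residue ring, it passes to integer powers without reduction.
\<close>

definition order_mod :: "int \<Rightarrow> int \<Rightarrow> nat \<Rightarrow> bool" where
  "order_mod p w k \<longleftrightarrow> (\<forall>j. [w ^ j = 1] (mod p) \<longleftrightarrow> k dvd j)"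

text \<open>
  As \<open>w\<close> is a root of \<open>X^k - 1\<close> modulo \<open>p\<close>, it is a root of the cyclotomic polynomial of some
  divisor \<open>d\<close> of \<open>k\<close>. Then it is a root of \<open>X^d - 1\<close> too, and the order forces \<open>d = k\<close>.
\<close>

lemma order_mod_dvd_cyclotomic_poly:
  assumes "prime p" "order_mod p w k" "k > 0"
  shows "p dvd poly (cyclotomic_poly k) w"
proof -
  have "p dvd poly (\<Prod>d | d dvd k. cyclotomic_poly d) w"
    using assms(2) by (simp add: prod_cyclotomic_poly[OF assms(3)] poly_monom order_mod_def
        flip: cong_iff_dvd_diff)
  then obtain d where d: "d dvd k" "p dvd poly (cyclotomic_poly d) w"
    using assms(1,3) by (auto simp: poly_prod prime_dvd_prod_iff)
  have "d > 0" using d(1) assms(3) by (auto intro: dvd_pos_nat)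
  have "poly (\<Prod>e | e dvd d. cyclotomic_poly e) w = poly (Polynomial.monom 1 d - 1) w"
    by (simp only: prod_cyclotomic_poly[OF \<open>d > 0\<close>])
  moreover have "poly (cyclotomic_poly d) w dvd poly (\<Prod>e | e dvd d. cyclotomic_poly e) w"
    unfolding poly_prod using \<open>d > 0\<close> by (intro dvd_prodI) auto
  ultimately have "p dvd w ^ d - 1"
    using d(2) by (auto simp: poly_monom intro: dvd_trans)
  hence "k dvd d" using assms(2) by (simp add: order_mod_def cong_iff_dvd_diff)
  hence "d = k" using d(1) by (simp add: dvd_antisym)
  thus ?thesis using d(2) by simp
qed

lemma order_mod_power:
  assumes "order_mod p w k" "coprime a k"
  shows "order_mod p (w ^ a) k"
  using assms coprime_dvd_mult_right_iff[of k a]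
  by (simp add: order_mod_def coprime_commute[of k a] flip: power_mult)

lemma order_mod_power_cong_iff:
  assumes "prime p" "order_mod p w k" "k > 0"
  shows "[w ^ a = w ^ b] (mod p) \<longleftrightarrow> [a = b] (mod k)"
proof -
  have "\<not> p dvd w"
  proof
    assume "p dvd w"
    hence "p dvd w ^ k" using assms(3) dvd_trans dvd_power by blast
    moreover have "[w ^ k = 1] (mod p)" using assms(2) by (simp add: order_mod_def)
    ultimately have "p dvd 1" using cong_dvd_iff by blast
    thus False using assms(1) by (auto dest: not_prime_unit)
  qed
  hence cop: "coprime (w ^ a) p" for a
    using assms(1) by (simp add: prime_imp_coprime coprime_commute)
  have le: "[w ^ a = w ^ b] (mod p) \<longleftrightarrow> [a = b] (mod k)" if "a \<le> b" for a b
  proof -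
    have "[w ^ a = w ^ b] (mod p) \<longleftrightarrow> [w ^ a * 1 = w ^ a * w ^ (b - a)] (mod p)"
      using that by (simp flip: power_add)
    also have "\<dots> \<longleftrightarrow> [w ^ (b - a) = 1] (mod p)"
      using cop by (simp only: cong_mult_lcancel cong_sym_eq)
    also have "\<dots> \<longleftrightarrow> k dvd b - a" using assms(2) by (simp add: order_mod_def)
    also have "\<dots> \<longleftrightarrow> [a = b] (mod k)" using cong_altdef_nat[OF that, of k] by (simp add: cong_sym_eq[of a])
    finally show ?thesis .
  qed
  show ?thesis using le[of a b] le[of b a] by (cases "a \<le> b") (auto simp: cong_sym_eq)
qed

text \<open>
  The powers \<open>w ^ a\<close> with \<open>a\<close> a totative are \<open>totient k\<close> incongruent roots of the cyclotomic
  polynomial modulo \<open>p\<close>, as many as its degree, so it is congruent to the product of the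
  \<open>X - w ^ a\<close>.
\<close>

lemma prime_dvd_resultant_cyclotomic_iff:
  fixes f :: "int poly"
  assumes "prime p" "order_mod p w k" "k > 0"
  shows "p dvd resultant f (cyclotomic_poly k) \<longleftrightarrow> (\<exists>a\<in>totatives k. p dvd poly f (w ^ a))"
proof -
  let ?A = "(\<lambda>a. w ^ a) ` totatives k"
  have eq: "a = b" if "a \<in> totatives k" "b \<in> totatives k" "[w ^ a = w ^ b] (mod p)" for a b
  proof -
    have ab: "0 < a" "a \<le> k" "0 < b" "b \<le> k" using that by (auto simp: totatives_def)
    have "[a = b] (mod k)" using that(3) order_mod_power_cong_iff[OF assms] by blast
    thus ?thesis using ab by (cases "a = k"; cases "b = k") (auto simp: cong_def)
  qed
  have inj: "inj_on (\<lambda>a. w ^ a) (totatives k)" by (rule inj_onI) (use eq in auto)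
  have roots: "[poly.coeff (cyclotomic_poly k) i = poly.coeff (\<Prod>c\<in>?A. [:-c, 1:]) i] (mod p)" for i
  proof (rule monic_cong_prod_roots)
    show "degree (cyclotomic_poly k) = card ?A"
      by (simp add: degree_cyclotomic_poly[OF assms(3)] card_image[OF inj] totient_def)
    show "p dvd poly (cyclotomic_poly k) c" if "c \<in> ?A" for c
      using that assms order_mod_power
      by (auto simp: totatives_def intro!: order_mod_dvd_cyclotomic_poly)
  qed (use assms lead_coeff_cyclotomic_poly eq in auto)
  have "[resultant (cyclotomic_poly k) f = resultant (\<Prod>c\<in>?A. [:-c, 1:]) f] (mod p)"
    by (rule resultant_cong)
       (use roots in \<open>auto simp: monic_prod_linear degree_cyclotomic_poly[OF assms(3)]
          card_image[OF inj] totient_def simp del: pCons_one\<close>)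
  moreover have "p dvd resultant f (cyclotomic_poly k) \<longleftrightarrow> p dvd resultant (cyclotomic_poly k) f"
    by (subst resultant_swap) (simp add: uminus_power_if)
  moreover have "resultant (\<Prod>c\<in>?A. [:-c, 1:]) f = (\<Prod>c\<in>?A. poly f c)"
    by (rule resultant_prod_linear) simp
  ultimately have "p dvd resultant f (cyclotomic_poly k) \<longleftrightarrow> p dvd (\<Prod>c\<in>?A. poly f c)"
    using cong_dvd_iff by metis
  thus ?thesis using assms(1) by (simp add: prime_dvd_prod_iff)
qed


section \<open>Non-injectivity as a root condition\<close>

context residues_prime
begin

lemma has_order_iff_order_mod:
  assumes "w \<in> {0..<int p}" "k > 0"
  shows "has_order p w k \<longleftrightarrow> order_mod (int p) w k"
proof -
  interpret G: group "mult_of R" by (rule field_mult_group)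
  have pow: "w [^] j = \<one> \<longleftrightarrow> [w ^ j = 1] (mod int p)" for j :: nat
    using pow_cong[of w j] assms(1) prime_gt_1_nat[OF p_prime]
    by (simp add: cong_def res_one_eq)
  show ?thesis
  proof
    assume w: "has_order p w k"
    hence "w \<in> carrier (mult_of R)" "G.ord w = k" by (auto simp: has_order_iff)
    thus "order_mod (int p) w k"
      unfolding order_mod_def pow[symmetric] using G.pow_eq_id[of w] by (simp add: nat_pow_mult_of)
  next
    assume w: "order_mod (int p) w k"
    hence "[w ^ k = 1] (mod int p)" "\<not> [0 ^ k = (1::int)] (mod int p)"
      using assms(2) prime_gt_1_nat[OF p_prime] by (auto simp: order_mod_def cong_def power_0_left)
    hence "w \<noteq> 0" by auto
    hence c: "w \<in> carrier (mult_of R)" using assms(1) by (simp add: res_carrier_eq res_zero_eq)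
    have "G.ord w = k"
    proof (rule dvd_antisym)
      show "G.ord w dvd k"
        using G.pow_eq_id[OF c, of k] w pow[of k] by (simp add: nat_pow_mult_of order_mod_def)
      show "k dvd G.ord w"
        using G.pow_ord_eq_1[OF c] w pow[of "G.ord w"] by (simp add: nat_pow_mult_of order_mod_def)
    qed
    thus "has_order p w k" using c by (simp add: has_order_iff)
  qed
qed

text \<open>
  The denominators \<open>\<omega>^u - \<omega>^v\<close> are units because \<open>u\<close> and \<open>v\<close> are distinct and less than \<open>k\<close>.
  Once they are cleared, the remaining equation can be compared with the polynomial by
  expanding both as integer expressions.
\<close>

lemma S_map_eq_iff:
  assumes "has_order p w k" "k > 0" "(u, v) \<in> pairs k" "(u', v') \<in> pairs k"
  shows "S_map p w (u, v) = S_map p w (u', v') \<longleftrightarrow> int p dvd poly (f_poly (u, v) (u', v')) w"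
proof -
  note w = has_order_powI[OF assms(1,2)]
  define a b a' b' where ab: "a = w [^] u" "b = w [^] v" "a' = w [^] u'" "b' = w [^] v'"
  have c: "a \<in> carrier R" "b \<in> carrier R" "a' \<in> carrier R" "b' \<in> carrier R" using w by (auto simp: ab)
  have "a \<noteq> b" "a' \<noteq> b'" using inj_onD[OF w(4), of u v] inj_onD[OF w(4), of u' v'] assms(3,4)
    by (auto simp: ab pairs_def)
  hence d: "a \<ominus> b \<in> Units R" "a' \<ominus> b' \<in> Units R" using c by (auto simp: field_Units)
  let ?n = "\<one> \<ominus> b" and ?n' = "\<one> \<ominus> b'" and ?d = "a \<ominus> b" and ?d' = "a' \<ominus> b'"
  have cc: "?n \<in> carrier R" "?n' \<in> carrier R" "?d \<in> carrier R" "?d' \<in> carrier R"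
    "inv ?d \<in> carrier R" "inv ?d' \<in> carrier R" using c d by auto
  have "S_map p w (u, v) = S_map p w (u', v') \<longleftrightarrow> \<ominus> (?n \<otimes> inv ?d) = \<ominus> (?n' \<otimes> inv ?d')"
    by (simp add: S_map_def Let_def R_def[symmetric] ab)
  also have "\<dots> \<longleftrightarrow> ?n \<otimes> inv ?d = ?n' \<otimes> inv ?d'"
    using cc by (metis m_closed minus_minus)
  also have "\<dots> \<longleftrightarrow> ?n \<otimes> ?d' = ?n' \<otimes> ?d"
  proof
    assume eq: "?n \<otimes> inv ?d = ?n' \<otimes> inv ?d'"
    have "?n \<otimes> ?d' = (?n \<otimes> inv ?d) \<otimes> (?d \<otimes> ?d')"
      using cc Units_l_inv[OF d(1)] by (metis m_assoc m_closed r_one l_one)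
    also have "\<dots> = (?n' \<otimes> inv ?d') \<otimes> (?d' \<otimes> ?d)" unfolding eq using cc by (simp add: m_comm)
    also have "\<dots> = ?n' \<otimes> ?d"
      using cc Units_l_inv[OF d(2)] by (metis m_assoc m_closed r_one l_one)
    finally show "?n \<otimes> ?d' = ?n' \<otimes> ?d" .
  next
    assume eq: "?n \<otimes> ?d' = ?n' \<otimes> ?d"
    have "?n \<otimes> inv ?d = (?n \<otimes> ?d') \<otimes> (inv ?d' \<otimes> inv ?d)"
      using cc Units_r_inv[OF d(2)] by (metis m_assoc m_closed r_one l_one)
    also have "\<dots> = (?n' \<otimes> ?d) \<otimes> (inv ?d \<otimes> inv ?d')" unfolding eq using cc by (simp add: m_comm)
    also have "\<dots> = ?n' \<otimes> inv ?d'"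
      using cc Units_r_inv[OF d(1)] by (metis m_assoc m_closed r_one l_one)
    finally show "?n \<otimes> inv ?d = ?n' \<otimes> inv ?d'" .
  qed
  also have "\<dots> \<longleftrightarrow> [(1 - w ^ v) * (w ^ u' - w ^ v') = (1 - w ^ v') * (w ^ u - w ^ v)] (mod int p)"
  proof -
    have wp: "w mod int p = w" using w(1) by (simp add: res_carrier_eq)
    have pow: "w [^] j = w ^ j mod int p" for j :: nat using pow_cong[of w j] wp by simp
    show ?thesis
      unfolding ab pow cong_def a_minus_def res_add_eq res_neg_eq res_mult_eq res_one_eq
      by (simp add: mod_simps)
  qed
  also have "\<dots> \<longleftrightarrow> int p dvd poly (f_poly (u, v) (u', v')) w"
    by (simp add: cong_iff_dvd_diff f_poly_def poly_monom algebra_simps)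
  finally show ?thesis .
qed

end

lemma S_map_not_inj_iff:
  assumes "prime r" "has_order r w k" "k > 0"
  shows "\<not> inj_on (S_map r w) (pairs k) \<longleftrightarrow>
    (\<exists>x\<in>pairs k. \<exists>y\<in>pairs k. x \<noteq> y \<and> int r dvd poly (f_poly x y) w)"
proof -
  interpret residues_prime r "residue_ring (int r)" by unfold_locales fact
  have "S_map r w x = S_map r w y \<longleftrightarrow> int r dvd poly (f_poly x y) w"
    if "x \<in> pairs k" "y \<in> pairs k" for x y
    using S_map_eq_iff[OF assms(2,3)] that by (cases x; cases y) auto
  thus ?thesis unfolding inj_on_def by blast
qed

lemma finite_pairs: "finite (pairs k)"
  by (rule finite_subset[of _ "{0..<k} \<times> {0..<k}"]) (auto simp: pairs_def)

theorem theorem3p2: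
  fixes k :: nat
  assumes "k \<ge> 1"
  shows "noninjective_primes k =
    prime_divisors_cong_1 k
      (\<Prod>(p, q)\<in>{(p, q). p \<in> pairs k \<and> q \<in> pairs k \<and> p \<noteq> q}.
         resultant (f_poly p q) (cyclotomic_poly k))"
proof -
  let ?I = "{(p, q). p \<in> pairs k \<and> q \<in> pairs k \<and> p \<noteq> q}"
  let ?N = "\<Prod>(p, q)\<in>?I. resultant (f_poly p q) (cyclotomic_poly k)"
  have k: "k > 0" using assms by simp
  have fin: "finite ?I"
    by (rule finite_subset[of _ "pairs k \<times> pairs k"]) (auto simp: finite_pairs)
  have "(\<exists>w. has_order r w k \<and> \<not> inj_on (S_map r w) (pairs k)) \<longleftrightarrow> int r dvd ?N"
    if r: "prime r" "[r = 1] (mod k)" for r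
  proof -
    interpret residues_prime r "residue_ring (int r)" by unfold_locales fact
    have pr: "prime (int r)" using r(1) by simp
    have order: "order_mod (int r) w k" if "has_order r w k" for w
      using has_order_iff_order_mod[of w k] has_order_powI(1)[OF that k] that k
      by (auto simp: res_carrier_eq)
    have N: "int r dvd ?N \<longleftrightarrow> (\<exists>x\<in>pairs k. \<exists>y\<in>pairs k. x \<noteq> y \<and>
        (\<exists>a\<in>totatives k. int r dvd poly (f_poly x y) (w ^ a)))" if "has_order r w k" for w
    proof -
      have "int r dvd ?N \<longleftrightarrow>
          (\<exists>(x, y)\<in>?I. int r dvd resultant (f_poly x y) (cyclotomic_poly k))"
        using prime_dvd_prod_iff[OF fin pr] by (simp add: case_prod_beta)
      thus ?thesis
        unfolding prime_dvd_resultant_cyclotomic_iff[OF pr order[OF that] k] by blast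
    qed
    show ?thesis
    proof
      assume "\<exists>w. has_order r w k \<and> \<not> inj_on (S_map r w) (pairs k)"
      then obtain w where w: "has_order r w k" "\<not> inj_on (S_map r w) (pairs k)" by blast
      have "1 \<in> totatives k" using k by (simp add: totatives_def)
      thus "int r dvd ?N" using S_map_not_inj_iff[OF r(1) w(1) k] w(2) N[OF w(1)]
        by (metis power_one_right)
    next
      assume dvd: "int r dvd ?N"
      obtain w where w: "has_order r w k" using ex_has_order[OF r(2) k] by blast
      then obtain x y a where xy: "x \<in> pairs k" "y \<in> pairs k" "x \<noteq> y"
        and a: "a \<in> totatives k" "int r dvd poly (f_poly x y) (w ^ a)"
        using N dvd by blast
      \<comment> \<open>the root \<open>w ^ a\<close> itself has order \<open>k\<close>; reduced, it is the element with a collision\<close>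
      let ?w = "w ^ a mod int r"
      have "order_mod (int r) (w ^ a) k"
        using order[OF w] a(1) by (intro order_mod_power) (auto simp: totatives_def)
      hence "order_mod (int r) ?w k" by (simp add: order_mod_def cong_def power_mod)
      hence w': "has_order r ?w k"
        using has_order_iff_order_mod[of ?w k] k r(1) by (simp add: prime_gt_0_nat)
      have "[poly (f_poly x y) ?w = poly (f_poly x y) (w ^ a)] (mod int r)"
        by (rule int_poly_cong) simp
      hence "int r dvd poly (f_poly x y) ?w" using a(2) cong_dvd_iff by blast
      thus "\<exists>w. has_order r w k \<and> \<not> inj_on (S_map r w) (pairs k)"
        using S_map_not_inj_iff[OF r(1) w' k] w' xy by blast
    qed
  qed
  thus ?thesis unfolding noninjective_primes_def prime_divisors_cong_1_def by blast
qed

end
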